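(* Let $m_t,n_t\ge 1$ and $m_r,n_r\ge 0$ be integers, and set $m_p=m_t+2m_r$, $n_p=n_t+2n_r$, $m_k=2m_r+1$, $n_k=2n_r+1$. For each $i_h\in\{1,\dots,m_t\}$ let $k(i_h)\in\mathbb{R}^{m_k\times n_k}$ be a kernel. Let $H:\mathbb{R}^{m_p\times n_p}\to\mathbb{R}^{m_t\times n_t}$ be the axially-variant convolution operator $$H=\sum_{i_h=1}^{m_t}\mathcal{Z}_t(i_h,i_h)\,\mathcal{C}_1(k(i_h))\,\mathcal{W}_p(i_h,i_h+2m_r).$$ Then the adjoint $H^T:\mathbb{R}^{m_t\times n_t}\to\mathbb{R}^{m_p\times n_p}$ is given by $$H^T=\sum_{i_h=1}^{m_t}\mathcal{Z}_p(i_h,i_h+2m_r)\,\mathcal{C}_2(\mathcal{R}(k(i_h)))\,\mathcal{W}_t(i_h,i_h).$$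
   Context: Images are real matrices, indexed from 1; adjoints (written $^T$) are taken with respect to the standard inner products $\langle u,v\rangle=\sum_{i,j}u_{i,j}v_{i,j}$. Valid convolution: for $k\in\mathbb{R}^{m_k\times n_k}$ and $a\in\mathbb{R}^{m_a\times n_a}$ with $m_a\ge m_k$, $n_a\ge n_k$, $\mathcal{C}_1(k)a\in\mathbb{R}^{(m_a-m_k+1)\times(n_a-n_k+1)}$ is $$(\mathcal{C}_1(k)a)_{i,j}=\sum_{p=1}^{m_k}\sum_{q=1}^{n_k}k_{p,q}\,a_{i-p+m_k,\,j-q+n_k}.$$ Full convolution: for $k\in\mathbb{R}^{m_k\times n_k}$ and $b\in\mathbb{R}^{m_b\times n_b}$ with $m_b,n_b\ge1$, $\mathcal{C}_2(k)b\in\mathbb{R}^{(m_b+m_k-1)\times(n_b+n_k-1)}$ is $$(\mathcal{C}_2(k)b)_{i,j}=\sum_{p=\max\{1,i-m_b+1\}}^{\min\{i,m_k\}}\ \sum_{q=\max\{1,j-n_b+1\}}^{\min\{j,n_k\}}k_{p,q}\,b_{i-p+1,\,j-q+1}.$$ Rotation: $\mathcal{R}(k)\in\mathbb{R}^{m_k\times n_k}$, $(\mathcal{R}(k))_{i,j}=k_{m_k-i+1,\,n_k-j+1}$. Full-width window and zero-padding: for $s\in\{t,p\}$ and $1\le i_1\le i_2\le m_s$, $\mathcal{W}_s(i_1,i_2):\mathbb{R}^{m_s\times n_s}\to\mathbb{R}^{(i_2-i_1+1)\times n_s}$ extracts rows $i_1,\dots,i_2$, i.e. $(\mathcal{W}_s(i_1,i_2)a)_{i,j}=a_{i+i_1-1,j}$;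 and $\mathcal{Z}_s(i_1,i_2):\mathbb{R}^{(i_2-i_1+1)\times n_s}\to\mathbb{R}^{m_s\times n_s}$ is $(\mathcal{Z}_s(i_1,i_2)a)_{i,j}=a_{i-i_1+1,j}$ if $i_1\le i\le i_2$, and $0$ otherwise. *)

theory Defs
  imports "Jordan_Normal_Form.Matrix"
begin

text \<open>Library matrices are indexed from 0. The functions \<open>px\<close> and \<open>img\<close> read and build
  matrices with indices starting at 1; they must only be used with indices at least 1.
  Index expressions on \<^typ>\<open>nat\<close> are arranged so that subtraction never truncates
  inside the index ranges that occur.\<close>

definition px :: "real mat \<Rightarrow> nat \<Rightarrow> nat \<Rightarrow> real" where
  "px a i j = a $$ (i - 1, j - 1)"

definition img :: "nat \<Rightarrow> nat \<Rightarrow> (nat \<Rightarrow> nat \<Rightarrow> real) \<Rightarrow> real mat" where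
  "img m n f = mat m n (\<lambda>(i, j). f (i + 1) (j + 1))"

definition img_inner :: "real mat \<Rightarrow> real mat \<Rightarrow> real" where
  "img_inner u v = (\<Sum>i = 1..dim_row u. \<Sum>j = 1..dim_col u. px u i j * px v i j)"

definition valid_conv :: "real mat \<Rightarrow> real mat \<Rightarrow> real mat" where
  "valid_conv k a =
     img (dim_row a - dim_row k + 1) (dim_col a - dim_col k + 1)
       (\<lambda>i j. \<Sum>p = 1..dim_row k. \<Sum>q = 1..dim_col k.
          px k p q * px a (i + dim_row k - p) (j + dim_col k - q))"

text \<open>Here the lower bounds may truncate to 0, which the maximum with 1 absorbs.\<close>

definition full_conv :: "real mat \<Rightarrow> real mat \<Rightarrow> real mat" where
  "full_conv k b =
     img (dim_row b + dim_row k - 1) (dim_col b + dim_col k - 1)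
       (\<lambda>i j. \<Sum>p = max 1 (i + 1 - dim_row b)..min i (dim_row k).
               \<Sum>q = max 1 (j + 1 - dim_col b)..min j (dim_col k).
          px k p q * px b (i + 1 - p) (j + 1 - q))"

definition rotation :: "real mat \<Rightarrow> real mat" where
  "rotation k = img (dim_row k) (dim_col k)
     (\<lambda>i j. px k (dim_row k + 1 - i) (dim_col k + 1 - j))"

text \<open>Window and zero-padding for images of size \<open>ms \<times> ns\<close>; the window does not depend
  on \<open>ms\<close>.\<close>

definition window :: "nat \<Rightarrow> nat \<Rightarrow> nat \<Rightarrow> nat \<Rightarrow> real mat \<Rightarrow> real mat" where
  "window ms ns i1 i2 a = img (i2 - i1 + 1) ns (\<lambda>i j. px a (i + i1 - 1) j)"

definition zero_pad :: "nat \<Rightarrow> nat \<Rightarrow> nat \<Rightarrow> nat \<Rightarrow> real mat \<Rightarrow> real mat" where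
  "zero_pad ms ns i1 i2 a =
     img ms ns (\<lambda>i j. if i1 \<le> i \<and> i \<le> i2 then px a (i + 1 - i1) j else 0)"

text \<open>Finite sum in the additive monoid of \<open>m \<times> n\<close> matrices, the matrix analogue of the
  library's \<^const>\<open>finsum_vec\<close>, and the pointwise sum of operators with values there.\<close>

definition img_sum :: "nat \<Rightarrow> nat \<Rightarrow> ('c \<Rightarrow> real mat) \<Rightarrow> 'c set \<Rightarrow> real mat" where
  "img_sum m n = finprod (monoid_mat TYPE(real) m n)"

definition op_sum ::
    "nat \<Rightarrow> nat \<Rightarrow> ('c \<Rightarrow> real mat \<Rightarrow> real mat) \<Rightarrow> 'c set \<Rightarrow> real mat \<Rightarrow> real mat" where
  "op_sum m n F I = (\<lambda>a. img_sum m n (\<lambda>i. F i a) I)"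

lemma img_sum_index:
  assumes "finite I" and "\<And>i. i \<in> I \<Longrightarrow> f i \<in> carrier_mat m n"
  shows "img_sum m n f I = mat m n (\<lambda>kl. \<Sum>i\<in>I. f i $$ kl)"
proof -
  interpret comm_monoid "monoid_mat TYPE(real) m n" by (rule comm_monoid_mat)
  have [simp]: "carrier (monoid_mat TYPE(real) m n) = carrier_mat m n"
    "mult (monoid_mat TYPE(real) m n) = (+)" "one (monoid_mat TYPE(real) m n) = 0\<^sub>m m n"
    by (simp_all add: monoid_mat_def)
  show ?thesis
    using assms unfolding img_sum_def
  proof (induction I)
    case empty
    show ?case by (auto intro!: eq_matI)
  next
    case (insert x F)
    then have "f \<in> F \<rightarrow> carrier_mat m n" "f x \<in> carrier_mat m n" by auto
    with insert show ?case by (auto intro!: eq_matI)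
  qed
qed

text \<open>Linear operators from \<open>m \<times> n\<close> to \<open>m' \<times> n'\<close> images; only values on the carrier
  matter.\<close>

definition lin_op :: "nat \<Rightarrow> nat \<Rightarrow> nat \<Rightarrow> nat \<Rightarrow> (real mat \<Rightarrow> real mat) set" where
  "lin_op m n m' n' =
     {T. T \<in> carrier_mat m n \<rightarrow> carrier_mat m' n' \<and>
         (\<forall>a\<in>carrier_mat m n. \<forall>b\<in>carrier_mat m n. T (a + b) = T a + T b) \<and>
         (\<forall>c. \<forall>a\<in>carrier_mat m n. T (c \<cdot>\<^sub>m a) = c \<cdot>\<^sub>m T a)}"

text \<open>The adjoint of \<open>T\<close>, a linear operator from \<open>m \<times> n\<close> to \<open>m' \<times> n'\<close> images. It is
  made unique as a total function by being undefined outside the carrier;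
  \<open>img_adjoint_ex1\<close> below shows that the description is proper.\<close>

definition img_adjoint ::
    "nat \<Rightarrow> nat \<Rightarrow> nat \<Rightarrow> nat \<Rightarrow> (real mat \<Rightarrow> real mat) \<Rightarrow> real mat \<Rightarrow> real mat" where
  "img_adjoint m n m' n' T =
     (THE S. S \<in> lin_op m' n' m n \<and> S \<in> extensional (carrier_mat m' n') \<and>
        (\<forall>a\<in>carrier_mat m n. \<forall>b\<in>carrier_mat m' n'. img_inner (T a) b = img_inner a (S b)))"

lemma img_inner_eq:
  assumes "u \<in> carrier_mat m n"
  shows "img_inner u v = (\<Sum>ij \<in> {..<m} \<times> {..<n}. u $$ ij * v $$ ij)"
proof -
  have *: "(\<Sum>i = 1..m. g i) = (\<Sum>i<m. g (Suc i))" for g :: "nat \<Rightarrow> real" and m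
    by (rule sum.reindex_bij_witness[where i = Suc and j = "\<lambda>i. i - 1"]) auto
  have "img_inner u v = (\<Sum>i<m. \<Sum>j<n. u $$ (i, j) * v $$ (i, j))"
    using assms unfolding img_inner_def px_def carrier_mat_def * by simp
  then show ?thesis
    unfolding sum.cartesian_product by (simp add: case_prod_unfold)
qed

definition unit_img :: "nat \<Rightarrow> nat \<Rightarrow> nat \<times> nat \<Rightarrow> real mat" where
  "unit_img m n ij = mat m n (\<lambda>kl. if kl = ij then 1 else 0)"

lemma unit_img_carrier [simp]: "unit_img m n ij \<in> carrier_mat m n"
  by (simp add: unit_img_def)

lemma img_inner_unit:
  assumes "ij \<in> {..<m} \<times> {..<n}"
  shows "img_inner (unit_img m n ij) v = v $$ ij"
proof -
  have "img_inner (unit_img m n ij) v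
      = (\<Sum>kl \<in> {..<m} \<times> {..<n}. if kl = ij then v $$ ij else 0)"
    unfolding img_inner_eq[OF unit_img_carrier]
    by (rule sum.cong) (auto simp: unit_img_def)
  also have "\<dots> = v $$ ij"
    using assms by (subst sum.delta) auto
  finally show ?thesis .
qed

lemma img_inner_add_right:
  assumes "a \<in> carrier_mat m n" "u \<in> carrier_mat m n" "v \<in> carrier_mat m n"
  shows "img_inner a (u + v) = img_inner a u + img_inner a v"
  unfolding img_inner_eq[OF assms(1)] sum.distrib[symmetric]
  by (rule sum.cong) (use assms in \<open>auto simp: algebra_simps\<close>)

lemma img_inner_smult_right:
  assumes "a \<in> carrier_mat m n" "u \<in> carrier_mat m n"
  shows "img_inner a (c \<cdot>\<^sub>m u) = c * img_inner a u"
  unfolding img_inner_eq[OF assms(1)] sum_distrib_left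
  by (rule sum.cong) (use assms in \<open>auto simp: algebra_simps\<close>)

lemma img_inner_add_left:
  assumes "u \<in> carrier_mat m n" "v \<in> carrier_mat m n"
  shows "img_inner (u + v) a = img_inner u a + img_inner v a"
proof -
  have "u + v \<in> carrier_mat m n" using assms by simp
  from img_inner_eq[OF this] show ?thesis
    unfolding img_inner_eq[OF assms(1)] img_inner_eq[OF assms(2)] sum.distrib[symmetric]
    by simp (rule sum.cong, use assms in \<open>auto simp: algebra_simps\<close>)
qed

lemma img_inner_smult_left:
  assumes "u \<in> carrier_mat m n"
  shows "img_inner (c \<cdot>\<^sub>m u) a = c * img_inner u a"
proof -
  have "c \<cdot>\<^sub>m u \<in> carrier_mat m n" using assms by simp
  from img_inner_eq[OF this] show ?thesis
    unfolding img_inner_eq[OF assms(1)] sum_distrib_left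
    by simp (rule sum.cong, use assms in \<open>auto simp: algebra_simps\<close>)
qed

lemma img_eqI:
  assumes "u \<in> carrier_mat m n" "v \<in> carrier_mat m n"
    and "\<And>a. a \<in> carrier_mat m n \<Longrightarrow> img_inner a u = img_inner a v"
  shows "u = v"
proof (rule eq_matI)
  fix i j assume "i < dim_row v" "j < dim_col v"
  then have "(i, j) \<in> {..<m} \<times> {..<n}" using assms by auto
  then show "u $$ (i, j) = v $$ (i, j)"
    using assms(3)[OF unit_img_carrier, of "(i, j)"] by (simp add: img_inner_unit)
qed (use assms in auto)

lemma img_adjoint_unique:
  assumes S: "S \<in> carrier_mat m' n' \<rightarrow> carrier_mat m n"
    and S': "S' \<in> carrier_mat m' n' \<rightarrow> carrier_mat m n"
    and "\<And>a b. a \<in> carrier_mat m n \<Longrightarrow> b \<in> carrier_mat m' n' \<Longrightarrow>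
           img_inner a (S b) = img_inner a (S' b)"
    and b: "b \<in> carrier_mat m' n'"
  shows "S b = S' b"
  using assms by (intro img_eqI[of _ m n]) auto

lemma lin_op_functional:
  assumes T: "T \<in> lin_op m n m' n'" and a: "a \<in> carrier_mat m n"
  shows "img_inner (T a) b =
    (\<Sum>ij \<in> {..<m} \<times> {..<n}. a $$ ij * img_inner (T (unit_img m n ij)) b)"
proof -
  have TC: "T u \<in> carrier_mat m' n'" if "u \<in> carrier_mat m n" for u
    using T that by (auto simp: lin_op_def)
  have Tadd: "T (u + v) = T u + T v" if "u \<in> carrier_mat m n" "v \<in> carrier_mat m n" for u v
    using T that by (auto simp: lin_op_def)
  have Tsm: "T (c \<cdot>\<^sub>m u) = c \<cdot>\<^sub>m T u" if "u \<in> carrier_mat m n" for c u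
    using T that by (auto simp: lin_op_def)
  define part where "part X = mat m n (\<lambda>ij. if ij \<in> X then a $$ ij else 0)" for X
  have pC: "part X \<in> carrier_mat m n" for X by (simp add: part_def)
  have "img_inner (T (part X)) b = (\<Sum>ij\<in>X. a $$ ij * img_inner (T (unit_img m n ij)) b)"
    if "finite X" for X
    using that
  proof induction
    case empty
    have "part {} = 0 \<cdot>\<^sub>m part {}"
      by (rule eq_matI) (auto simp: part_def)
    then have "T (part {}) = 0 \<cdot>\<^sub>m T (part {})" using Tsm[OF pC] by metis
    then have "img_inner (T (part {})) b = 0 * img_inner (T (part {})) b"
      using img_inner_smult_left[OF TC[OF pC]] by metis
    then show ?case by simp
  next
    case (insert x X)
    have "part (insert x X) = a $$ x \<cdot>\<^sub>m unit_img m n x + part X"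
      by (rule eq_matI) (use insert in \<open>auto simp: part_def unit_img_def\<close>)
    then have "T (part (insert x X)) = a $$ x \<cdot>\<^sub>m T (unit_img m n x) + T (part X)"
      by (simp add: Tadd Tsm pC)
    then have "img_inner (T (part (insert x X))) b
        = a $$ x * img_inner (T (unit_img m n x)) b + img_inner (T (part X)) b"
      by (simp add: img_inner_add_left[of _ m' n'] img_inner_smult_left[of _ m' n'] TC pC)
    with insert show ?case by simp
  qed
  moreover have "part ({..<m} \<times> {..<n}) = a"
    by (rule eq_matI) (use a in \<open>auto simp: part_def\<close>)
  ultimately show ?thesis by (metis finite_cartesian_product finite_lessThan)
qed

lemma img_adjoint_ex1:
  assumes T: "T \<in> lin_op m n m' n'"
  shows "\<exists>!S. S \<in> lin_op m' n' m n \<and> S \<in> extensional (carrier_mat m' n') \<and>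
    (\<forall>a\<in>carrier_mat m n. \<forall>b\<in>carrier_mat m' n'. img_inner (T a) b = img_inner a (S b))"
    (is "\<exists>!S. ?P S")
proof -
  have TC: "T u \<in> carrier_mat m' n'" if "u \<in> carrier_mat m n" for u
    using T that by (auto simp: lin_op_def)
  define S where "S = restrict
    (\<lambda>b. mat m n (\<lambda>ij. img_inner (T (unit_img m n ij)) b)) (carrier_mat m' n')"
  have "S \<in> lin_op m' n' m n"
    unfolding lin_op_def S_def
    by (auto intro!: eq_matI simp: img_inner_add_right[OF TC] img_inner_smult_right[OF TC])
  moreover have "img_inner (T a) b = img_inner a (S b)"
    if "a \<in> carrier_mat m n" "b \<in> carrier_mat m' n'" for a b
    unfolding lin_op_functional[OF T that(1)] img_inner_eq[OF that(1)]
    by (rule sum.cong) (use that in \<open>auto simp: S_def\<close>)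
  moreover have "S \<in> extensional (carrier_mat m' n')"
    by (simp add: S_def)
  ultimately have "?P S" by blast
  moreover have "S1 = S2" if "?P S1" "?P S2" for S1 S2
  proof (rule extensionalityI)
    show "S1 \<in> extensional (carrier_mat m' n')" "S2 \<in> extensional (carrier_mat m' n')"
      using that by blast+
    fix b :: "real mat" assume b: "b \<in> carrier_mat m' n'"
    show "S1 b = S2 b"
    proof (rule img_adjoint_unique[OF _ _ _ b])
      show "S1 \<in> carrier_mat m' n' \<rightarrow> carrier_mat m n" "S2 \<in> carrier_mat m' n' \<rightarrow> carrier_mat m n"
        using that unfolding lin_op_def by blast+
      show "img_inner a (S1 c) = img_inner a (S2 c)"
        if "a \<in> carrier_mat m n" "c \<in> carrier_mat m' n'" for a c
        using \<open>?P S1\<close> \<open>?P S2\<close> that by metis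
    qed
  qed
  ultimately show ?thesis by blast
qed

lemma img_adjoint_spec:
  assumes "T \<in> lin_op m n m' n'"
  shows "img_adjoint m n m' n' T \<in> lin_op m' n' m n"
    and "img_adjoint m n m' n' T \<in> extensional (carrier_mat m' n')"
    and "a \<in> carrier_mat m n \<Longrightarrow> b \<in> carrier_mat m' n' \<Longrightarrow>
      img_inner (T a) b = img_inner a (img_adjoint m n m' n' T b)"
  using theI'[OF img_adjoint_ex1[OF assms]] unfolding img_adjoint_def by blast+

end

(* A pair of maps T, S with <T a, b> = <a, S b> on the carriers consists of linear maps, because
   the inner product is nondegenerate, and then S is the adjoint of T. Such pairs are closed under
   composition (in reverse order) and sums, so only two pairs have to be exhibited: zero-padding
   with window, and valid convolution with full convolution by the rotated kernel. The latter is
   the substitution (i, p) |-> (i + m - p, m + 1 - p) in each coordinate. *)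
theory Submission
  imports Defs
begin

text \<open>A relation in place of \<open>img_adjoint\<close>: linearity and extensionality are left
  out, so it is symmetric and passes directly to compositions and finite sums.\<close>

definition adjoint_pair ::
    "nat \<Rightarrow> nat \<Rightarrow> nat \<Rightarrow> nat \<Rightarrow> (real mat \<Rightarrow> real mat) \<Rightarrow> (real mat \<Rightarrow> real mat) \<Rightarrow> bool" where
  "adjoint_pair m n m' n' T S \<longleftrightarrow>
     T \<in> carrier_mat m n \<rightarrow> carrier_mat m' n' \<and> S \<in> carrier_mat m' n' \<rightarrow> carrier_mat m n \<and>
     (\<forall>a\<in>carrier_mat m n. \<forall>b\<in>carrier_mat m' n'. img_inner (T a) b = img_inner a (S b))"

lemma adjoint_pairI:
  assumes "\<And>a. a \<in> carrier_mat m n \<Longrightarrow> T a \<in> carrier_mat m' n'"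
    and "\<And>b. b \<in> carrier_mat m' n' \<Longrightarrow> S b \<in> carrier_mat m n"
    and "\<And>a b. a \<in> carrier_mat m n \<Longrightarrow> b \<in> carrier_mat m' n' \<Longrightarrow>
           img_inner (T a) b = img_inner a (S b)"
  shows "adjoint_pair m n m' n' T S"
  using assms by (auto simp: adjoint_pair_def)

lemma adjoint_pairD:
  assumes "adjoint_pair m n m' n' T S"
  shows "a \<in> carrier_mat m n \<Longrightarrow> T a \<in> carrier_mat m' n'"
    and "b \<in> carrier_mat m' n' \<Longrightarrow> S b \<in> carrier_mat m n"
    and "a \<in> carrier_mat m n \<Longrightarrow> b \<in> carrier_mat m' n' \<Longrightarrow>
           img_inner (T a) b = img_inner a (S b)"
  using assms by (auto simp: adjoint_pair_def)

lemma img_inner_commute: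
  assumes "u \<in> carrier_mat m n" "v \<in> carrier_mat m n"
  shows "img_inner u v = img_inner v u"
  unfolding img_inner_eq[OF assms(1)] img_inner_eq[OF assms(2)] by (simp add: mult.commute)

lemma adjoint_pair_sym:
  assumes "adjoint_pair m n m' n' T S"
  shows "adjoint_pair m' n' m n S T"
proof (rule adjoint_pairI)
  fix a b :: "real mat" assume "a \<in> carrier_mat m' n'" "b \<in> carrier_mat m n"
  then show "img_inner (S a) b = img_inner a (T b)"
    using adjoint_pairD[OF assms] img_inner_commute by metis
qed (use adjoint_pairD[OF assms] in auto)

text \<open>For every \<open>c\<close>, \<open>img_inner c (T a) = img_inner (S c) a\<close> is
  linear in \<open>a\<close>; nondegeneracy of the inner product carries this over to
  \<open>T\<close> itself.\<close>

lemma adjoint_pair_lin_op: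
  assumes "adjoint_pair m n m' n' T S"
  shows "T \<in> lin_op m n m' n'"
proof -
  note T = adjoint_pairD(1)[OF assms]
  \<comment> \<open>Oriented so that rewriting removes \<open>T\<close> from the second argument,
    where linearity of \<open>img_inner\<close> then applies.\<close>
  note S = adjoint_pairD(1)[OF adjoint_pair_sym[OF assms]]
    adjoint_pairD(3)[OF adjoint_pair_sym[OF assms], symmetric]
  have "T (a + b) = T a + T b" if "a \<in> carrier_mat m n" "b \<in> carrier_mat m n" for a b
  proof (rule img_eqI[of _ m' n'])
    show "img_inner c (T (a + b)) = img_inner c (T a + T b)" if c: "c \<in> carrier_mat m' n'" for c
      using that \<open>a \<in> _\<close> \<open>b \<in> _\<close>
      by (simp add: img_inner_add_right[of _ m' n'] img_inner_add_right[of _ m n] T S)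
  qed (use that T in auto)
  moreover have "T (r \<cdot>\<^sub>m a) = r \<cdot>\<^sub>m T a" if "a \<in> carrier_mat m n" for r a
  proof (rule img_eqI[of _ m' n'])
    show "img_inner c (T (r \<cdot>\<^sub>m a)) = img_inner c (r \<cdot>\<^sub>m T a)" if c: "c \<in> carrier_mat m' n'" for c
      using that \<open>a \<in> _\<close>
      by (simp add: img_inner_smult_right[of _ m' n'] img_inner_smult_right[of _ m n] T S)
  qed (use that T in auto)
  ultimately show ?thesis
    using T by (auto simp: lin_op_def)
qed

text \<open>On the carrier this is uniqueness of adjoints. The restriction makes it an equality of
  total functions, as \<open>img_adjoint\<close> is extensional.\<close>

lemma adjoint_pair_img_adjoint:
  assumes "adjoint_pair m n m' n' T S"
  shows "img_adjoint m n m' n' T = restrict S (carrier_mat m' n')"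
proof -
  note spec = img_adjoint_spec[OF adjoint_pair_lin_op[OF assms]]
  show ?thesis
  proof (rule extensionalityI)
    fix b :: "real mat" assume b: "b \<in> carrier_mat m' n'"
    have "img_adjoint m n m' n' T b = S b"
    proof (rule img_adjoint_unique[OF _ _ _ b])
      show "img_adjoint m n m' n' T \<in> carrier_mat m' n' \<rightarrow> carrier_mat m n"
        using spec(1) by (simp add: lin_op_def)
    qed (use spec(3) adjoint_pairD[OF assms] in auto)
    then show "img_adjoint m n m' n' T b = restrict S (carrier_mat m' n') b"
      using b by simp
  qed (use spec(2) in auto)
qed

lemma adjoint_pair_comp:
  assumes "adjoint_pair m n m' n' T S" "adjoint_pair m' n' m'' n'' T' S'"
  shows "adjoint_pair m n m'' n'' (T' \<circ> T) (S \<circ> S')"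
  using adjoint_pairD[OF assms(1)] adjoint_pairD[OF assms(2)]
  by (intro adjoint_pairI) simp_all

lemma img_sum_carrier:
  assumes "finite I" and "\<And>i. i \<in> I \<Longrightarrow> f i \<in> carrier_mat m n"
  shows "img_sum m n f I \<in> carrier_mat m n"
  using img_sum_index[of I f m n, OF assms] by simp

lemma img_inner_sum_right:
  assumes "finite I" and "\<And>i. i \<in> I \<Longrightarrow> f i \<in> carrier_mat m n" and "a \<in> carrier_mat m n"
  shows "img_inner a (img_sum m n f I) = (\<Sum>i\<in>I. img_inner a (f i))"
proof -
  have sum: "img_sum m n f I = mat m n (\<lambda>kl. \<Sum>i\<in>I. f i $$ kl)"
    using assms(1,2) by (rule img_sum_index)
  have "img_inner a (img_sum m n f I)
      = (\<Sum>ij \<in> {..<m} \<times> {..<n}. \<Sum>i\<in>I. a $$ ij * f i $$ ij)"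
    unfolding img_inner_eq[OF assms(3)] sum
    by (rule sum.cong) (auto simp: sum_distrib_left)
  also have "\<dots> = (\<Sum>i\<in>I. img_inner a (f i))"
    unfolding img_inner_eq[OF assms(3)] by (rule sum.swap)
  finally show ?thesis .
qed

lemma adjoint_pair_op_sum:
  assumes "finite I" and F: "\<And>i. i \<in> I \<Longrightarrow> adjoint_pair m n m' n' (F i) (G i)"
  shows "adjoint_pair m n m' n' (op_sum m' n' F I) (op_sum m n G I)"
proof (rule adjoint_pairI)
  note D = adjoint_pairD[OF F]
  fix a b :: "real mat"
  show "op_sum m' n' F I a \<in> carrier_mat m' n'" if "a \<in> carrier_mat m n"
    unfolding op_sum_def using that D assms(1) by (intro img_sum_carrier) auto
  show "op_sum m n G I b \<in> carrier_mat m n" if "b \<in> carrier_mat m' n'"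
    unfolding op_sum_def using that D assms(1) by (intro img_sum_carrier) auto
  assume a: "a \<in> carrier_mat m n" and b: "b \<in> carrier_mat m' n'"
  \<comment> \<open>\<open>img_inner_sum_right\<close> expands only the second argument, so the sum
    is moved there first; the summands are swapped back one by one below.\<close>
  have "img_inner (op_sum m' n' F I a) b = img_inner b (op_sum m' n' F I a)"
    by (rule img_inner_commute[OF _ b])
      (unfold op_sum_def, use a D assms(1) in \<open>auto intro!: img_sum_carrier\<close>)
  also have "\<dots> = (\<Sum>i\<in>I. img_inner b (F i a))"
    unfolding op_sum_def using a b D assms(1) by (intro img_inner_sum_right) auto
  also have "\<dots> = (\<Sum>i\<in>I. img_inner a (G i b))"
    using a b D img_inner_commute by (intro sum.cong) metis+
  also have "\<dots> = img_inner a (op_sum m n G I b)"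
    unfolding op_sum_def using a b D assms(1) by (intro img_inner_sum_right[symmetric]) auto
  finally show "img_inner (op_sum m' n' F I a) b = img_inner a (op_sum m n G I b)" .
qed

lemma img_carrier [simp]: "img m n f \<in> carrier_mat m n"
  by (simp add: img_def)

lemma dim_img [simp]: "dim_row (img m n f) = m" "dim_col (img m n f) = n"
  by (simp_all add: img_def)

lemma px_img [simp]:
  "1 \<le> i \<Longrightarrow> i \<le> m \<Longrightarrow> 1 \<le> j \<Longrightarrow> j \<le> n \<Longrightarrow> px (img m n f) i j = f i j"
  by (simp add: px_def img_def)

text \<open>Shifting the row index by \<open>i1 - 1\<close> turns the inner product over the window
  into one over rows \<open>i1\<close> to \<open>i2\<close> of the large image.\<close>

lemma adjoint_pair_window_zero_pad:
  assumes "1 \<le> i1" "i1 \<le> i2" "i2 \<le> m"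
  shows "adjoint_pair m n (i2 - i1 + 1) n (window m n i1 i2) (zero_pad m n i1 i2)"
proof (rule adjoint_pairI)
  fix a b :: "real mat"
  assume a: "a \<in> carrier_mat m n" and b: "b \<in> carrier_mat (i2 - i1 + 1) n"
  have "img_inner (window m n i1 i2 a) b
      = (\<Sum>i = 1..i2 - i1 + 1. \<Sum>j = 1..n. px a (i + i1 - 1) j * px b i j)"
    by (simp add: img_inner_def window_def)
  also have "\<dots> = (\<Sum>i = i1..i2. \<Sum>j = 1..n. px a i j * px b (i + 1 - i1) j)"
    by (rule sum.reindex_bij_witness[where i = "\<lambda>i. i + 1 - i1" and j = "\<lambda>i. i + i1 - 1"])
      (use assms in auto)
  \<comment> \<open>The rows added to the range contribute 0 because of the padding.\<close>
  also have "\<dots> = (\<Sum>i = 1..m. \<Sum>j = 1..n.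
      px a i j * (if i1 \<le> i \<and> i \<le> i2 then px b (i + 1 - i1) j else 0))"
    by (rule sum.mono_neutral_cong_left) (use assms in auto)
  also have "\<dots> = img_inner a (zero_pad m n i1 i2 b)"
    using a by (simp add: img_inner_def zero_pad_def)
  finally show "img_inner (window m n i1 i2 a) b = img_inner a (zero_pad m n i1 i2 b)" .
qed (auto simp: window_def zero_pad_def)

text \<open>The substitution sends \<open>(i, p)\<close> to \<open>(i + m - p, m + 1 - p)\<close>.
  In the new variables the old \<open>i\<close> is \<open>x + 1 - p\<close>, and
  \<open>1 \<le> x + 1 - p \<le> M\<close> together with \<open>1 \<le> p \<le> m\<close> gives
  exactly the summation bounds of the full convolution.\<close>

lemma sum_conv_reindex:
  fixes f :: "nat \<Rightarrow> nat \<Rightarrow> 'a :: comm_monoid_add"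
  assumes "M \<ge> 1"
  shows "(\<Sum>i = 1..M. \<Sum>p = 1..m. f i p) =
    (\<Sum>x = 1..M + m - 1. \<Sum>p = max 1 (x + 1 - M)..min x m. f (x + 1 - p) (m + 1 - p))"
proof -
  \<comment> \<open>The new range of \<open>p\<close> depends on \<open>x\<close>, so the bijection
    is between sets of dependent pairs.\<close>
  have "(\<Sum>(i, p) \<in> (SIGMA i:{1..M}. {1..m}). f i p) =
    (\<Sum>(x, p) \<in> (SIGMA x:{1..M + m - 1}. {max 1 (x + 1 - M)..min x m}).
       f (x + 1 - p) (m + 1 - p))"
    by (rule sum.reindex_bij_witness[where i = "\<lambda>(x, p). (x + 1 - p, m + 1 - p)"
          and j = "\<lambda>(i, p). (i + m - p, m + 1 - p)"])
      (use assms in auto)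
  then show ?thesis
    by (simp add: sum.Sigma)
qed

lemma adjoint_pair_valid_conv_full_conv:
  assumes k: "k \<in> carrier_mat mk nk" and "mk \<le> ma" "nk \<le> na"
  shows "adjoint_pair ma na (ma - mk + 1) (na - nk + 1)
    (valid_conv k) (full_conv (rotation k))"
proof (rule adjoint_pairI)
  \<comment> \<open>The size of the valid convolution; a full convolution of an \<open>M\<close> by
    \<open>N\<close> image with the kernel has size \<open>ma\<close> by \<open>na\<close>
    again.\<close>
  define M N where "M = ma - mk + 1" and "N = na - nk + 1"
  have MN: "M \<ge> 1" "N \<ge> 1" "M + mk - 1 = ma" "N + nk - 1 = na"
    using assms by (auto simp: M_def N_def)
  have dim_k: "dim_row k = mk" "dim_col k = nk"
    using k by auto
  fix a b :: "real mat"
  show "valid_conv k a \<in> carrier_mat (ma - mk + 1) (na - nk + 1)" if "a \<in> carrier_mat ma na"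
    using that by (simp add: valid_conv_def dim_k img_def)
  show "full_conv (rotation k) b \<in> carrier_mat ma na"
    if "b \<in> carrier_mat (ma - mk + 1) (na - nk + 1)"
    using that MN by (simp add: full_conv_def rotation_def dim_k img_def assms)
  assume a: "a \<in> carrier_mat ma na" and "b \<in> carrier_mat (ma - mk + 1) (na - nk + 1)"
  then have b: "b \<in> carrier_mat M N" by (simp add: M_def N_def)
  define P where "P x = {max 1 (x + 1 - M)..min x mk}" for x
  define Q where "Q y = {max 1 (y + 1 - N)..min y nk}" for y
  have "img_inner (valid_conv k a) b = (\<Sum>i = 1..M. \<Sum>j = 1..N. \<Sum>p = 1..mk. \<Sum>q = 1..nk.
      px k p q * px a (i + mk - p) (j + nk - q) * px b i j)"
    using a by (simp add: img_inner_def valid_conv_def dim_k M_def N_def sum_distrib_right)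
  \<comment> \<open>Bringing \<open>i\<close> next to \<open>p\<close> and \<open>j\<close> next to
    \<open>q\<close> allows the one-dimensional substitution to be applied to rows and columns
    separately.\<close>
  also have "\<dots> = (\<Sum>i = 1..M. \<Sum>p = 1..mk. \<Sum>j = 1..N. \<Sum>q = 1..nk.
      px k p q * px a (i + mk - p) (j + nk - q) * px b i j)"
    by (intro sum.cong refl sum.swap)
  also have "\<dots> = (\<Sum>x = 1..ma. \<Sum>p\<in>P x. \<Sum>y = 1..na. \<Sum>q\<in>Q y.
      px k (mk + 1 - p) (nk + 1 - q)
        * px a (x + 1 - p + mk - (mk + 1 - p)) (y + 1 - q + nk - (nk + 1 - q))
        * px b (x + 1 - p) (y + 1 - q))"
    unfolding sum_conv_reindex[OF MN(1)] sum_conv_reindex[OF MN(2)] MN P_def Q_def ..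
  also have "\<dots> = (\<Sum>x = 1..ma. \<Sum>p\<in>P x. \<Sum>y = 1..na. \<Sum>q\<in>Q y.
      px a x y * (px (rotation k) p q * px b (x + 1 - p) (y + 1 - q)))"
  proof (intro sum.cong refl)
    fix x p y q assume "p \<in> P x" "q \<in> Q y"
    then have pq: "1 \<le> p" "p \<le> x" "p \<le> mk" "1 \<le> q" "q \<le> y" "q \<le> nk"
      by (auto simp: P_def Q_def)
    \<comment> \<open>The bounds on \<open>p\<close> and \<open>q\<close> rule out truncated
      subtraction. The index into \<open>a\<close> becomes \<open>(x, y)\<close>, and the reversed
      kernel index is that of the rotation.\<close>
    then have "x + 1 - p + mk - (mk + 1 - p) = x" "y + 1 - q + nk - (nk + 1 - q) = y"
      by auto
    with pq show "px k (mk + 1 - p) (nk + 1 - q)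
        * px a (x + 1 - p + mk - (mk + 1 - p)) (y + 1 - q + nk - (nk + 1 - q))
        * px b (x + 1 - p) (y + 1 - q)
      = px a x y * (px (rotation k) p q * px b (x + 1 - p) (y + 1 - q))"
      by (simp add: rotation_def dim_k)
  qed
  also have "\<dots> = (\<Sum>x = 1..ma. \<Sum>y = 1..na. \<Sum>p\<in>P x. \<Sum>q\<in>Q y.
      px a x y * (px (rotation k) p q * px b (x + 1 - p) (y + 1 - q)))"
    by (intro sum.cong refl sum.swap)
  also have "\<dots> = (\<Sum>x = 1..ma. \<Sum>y = 1..na. px a x y * px (full_conv (rotation k) b) x y)"
  proof (intro sum.cong refl)
    fix x y assume xy: "x \<in> {1..ma}" "y \<in> {1..na}"
    have dims: "dim_row b = M" "dim_col b = N"
      "dim_row (rotation k) = mk" "dim_col (rotation k) = nk"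
      using b by (auto simp: rotation_def dim_k)
    \<comment> \<open>\<open>P x\<close> and \<open>Q y\<close> are the summation ranges in
      \<open>full_conv\<close>, since rotation preserves the kernel size.\<close>
    have "px (full_conv (rotation k) b) x y
        = (\<Sum>p\<in>P x. \<Sum>q\<in>Q y. px (rotation k) p q * px b (x + 1 - p) (y + 1 - q))"
      unfolding full_conv_def dims MN P_def Q_def using xy by (intro px_img) auto
    then show "(\<Sum>p\<in>P x. \<Sum>q\<in>Q y. px a x y * (px (rotation k) p q * px b (x + 1 - p) (y + 1 - q)))
        = px a x y * px (full_conv (rotation k) b) x y"
      by (simp add: sum_distrib_left)
  qed
  also have "\<dots> = img_inner a (full_conv (rotation k) b)"
    using a by (simp add: img_inner_def)
  finally show "img_inner (valid_conv k a) b = img_inner a (full_conv (rotation k) b)" .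
qed

theorem mainTheorem1:
  fixes mt nt mr nr mp np mk nk :: nat
    and k :: "nat \<Rightarrow> real mat"
    and H :: "real mat \<Rightarrow> real mat"
  assumes "mt \<ge> 1" and "nt \<ge> 1"
    and "mp = mt + 2 * mr" and "np = nt + 2 * nr"
    and "mk = 2 * mr + 1" and "nk = 2 * nr + 1"
    and "\<And>ih. ih \<in> {1..mt} \<Longrightarrow> k ih \<in> carrier_mat mk nk"
    and "H = op_sum mt nt
           (\<lambda>ih. zero_pad mt nt ih ih \<circ> valid_conv (k ih) \<circ> window mp np ih (ih + 2 * mr))
           {1..mt}"
  shows "H \<in> lin_op mp np mt nt \<and>
         img_adjoint mp np mt nt H =
           restrict
             (op_sum mp np
               (\<lambda>ih. zero_pad mp np ih (ih + 2 * mr) \<circ> full_conv (rotation (k ih))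
                       \<circ> window mt nt ih ih)
               {1..mt})
             (carrier_mat mt nt)"
proof -
  define G where "G = (\<lambda>ih. zero_pad mp np ih (ih + 2 * mr) \<circ> full_conv (rotation (k ih))
    \<circ> window mt nt ih ih)"
  have "adjoint_pair mp np mt nt
      (zero_pad mt nt ih ih \<circ> valid_conv (k ih) \<circ> window mp np ih (ih + 2 * mr)) (G ih)"
    if ih: "ih \<in> {1..mt}" for ih
  proof -
    \<comment> \<open>The window has \<open>2 * mr + 1 = mk\<close> rows and ends within the image
      since \<open>ih \<le> mt\<close>.\<close>
    have W: "adjoint_pair mp np mk np (window mp np ih (ih + 2 * mr)) (zero_pad mp np ih (ih + 2 * mr))"
      using adjoint_pair_window_zero_pad[of ih "ih + 2 * mr" mp np] ih assms(3,5) by simp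
    \<comment> \<open>The window is as high as the kernel, which leaves one output row; the width is
      \<open>np - nk + 1 = nt\<close>, and \<open>nt \<ge> 1\<close> makes the kernel fit.\<close>
    have C: "adjoint_pair mk np 1 nt (valid_conv (k ih)) (full_conv (rotation (k ih)))"
      using adjoint_pair_valid_conv_full_conv[OF assms(7)[OF ih], of mk np] assms(2,4,6) by simp
    \<comment> \<open>Here padding is the forward map, hence the use of symmetry.\<close>
    have Z: "adjoint_pair 1 nt mt nt (zero_pad mt nt ih ih) (window mt nt ih ih)"
      using adjoint_pair_sym[OF adjoint_pair_window_zero_pad[of ih ih mt nt]] ih by simp
    show ?thesis
      using adjoint_pair_comp[OF W adjoint_pair_comp[OF C Z]] by (simp add: G_def comp_assoc)
  qed
  then have "adjoint_pair mp np mt nt H (op_sum mp np G {1..mt})"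
    unfolding assms(8) by (intro adjoint_pair_op_sum) auto
  then show ?thesis
    using adjoint_pair_lin_op adjoint_pair_img_adjoint unfolding G_def by blast
qed

end
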